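(* Let $n\ge 2$ and $k,n\in\mathbb{N}$. The path $P_n$ on $n$ vertices is $k$-distance magic if and only if $k=1$ and $n=3$.
   Context: All graphs are finite, simple and undirected; $d(u,v)$ is graph distance. For $u\in V(G)$ and $k\in\mathbb{N}$, $\partial N_k(u)=\{v\in V(G): d(u,v)=k\}$. For a graph $G$ of order $n\ge3$, a $k$-distance magic labeling ($k$-DML) is a bijection $f:V(G)\to\{1,\dots,n\}$ together with a constant $M$ such that $\sum_{w\in\partial N_k(u)} f(w)=M$ for every vertex $u$ with $\partial N_k(u)\neq\emptyset$; moreover $G$ is required to contain at least one pair of vertices at distance $k$. $G$ is $k$-distance magic ($k$-DM) if it has a $k$-DML. *)

theory Defs
  imports "Graph_Theory.Graph_Theory"
begin

text \<open>
  In the locale \<^locale>\<open>graph\<close> (finite, symmetric, without loops and multiple arcs) an undirected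
  edge is a pair of opposite arcs, so the graph distance is the least cost \<open>\<mu>\<close> of a walk
  when every arc costs 1 (with value \<open>\<infinity>\<close> if there is no walk).
\<close>

context graph
begin

definition distance :: "'a \<Rightarrow> 'a \<Rightarrow> ereal" where
  "distance u v = \<mu> (\<lambda>_. 1) u v"

definition boundary_nbhd :: "nat \<Rightarrow> 'a \<Rightarrow> 'a set" where
  "boundary_nbhd k u = {v \<in> verts G. distance u v = ereal (real k)}"

text \<open>Labelings are considered for graphs of order at least 3 only. Values of \<open>f\<close> outside
  \<^term>\<open>verts G\<close> are irrelevant.\<close>

definition distance_magic_labeling :: "nat \<Rightarrow> ('a \<Rightarrow> nat) \<Rightarrow> nat \<Rightarrow> bool" where
  "distance_magic_labeling k f M \<longleftrightarrow>
     card (verts G) \<ge> 3 \<and>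
     (\<exists>u\<in>verts G. \<exists>v\<in>verts G. distance u v = ereal (real k)) \<and>
     bij_betw f (verts G) {1..card (verts G)} \<and>
     (\<forall>u\<in>verts G. boundary_nbhd k u \<noteq> {} \<longrightarrow> (\<Sum>w\<in>boundary_nbhd k u. f w) = M)"

definition distance_magic :: "nat \<Rightarrow> bool" where
  "distance_magic k \<longleftrightarrow> (\<exists>f M. distance_magic_labeling k f M)"

end

definition path_graph :: "nat \<Rightarrow> nat pair_pre_digraph" where
  "path_graph n = \<lparr> pverts = {1..n},
     parcs = {(i, j). i \<in> {1..n} \<and> j \<in> {1..n} \<and> (j = i + 1 \<or> i = j + 1)} \<rparr>"

lemma pair_graph_path_graph: "pair_graph (path_graph n)"
proof
  have "parcs (path_graph n) \<subseteq> {1..n} \<times> {1..n}"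
    by (auto simp: path_graph_def)
  then show "finite (parcs (path_graph n))"
    by (rule finite_subset) simp
qed (auto simp: path_graph_def symmetric_def sym_def)

lemma graph_path_graph: "graph (with_proj (path_graph n))"
  by (rule pair_graph.pair_graphD_graph[OF pair_graph_path_graph])

end

theory Submission
  imports Defs
begin

text \<open>
  The distance of two vertices of the path is their difference. Suppose there is a \<open>k\<close>-DML. The
  case \<open>k = 0\<close> makes the labeling constant. Otherwise the end vertices \<open>1\<close> and \<open>n\<close> each see a single
  vertex, \<open>1 + k\<close> and \<open>n - k\<close>, both with label \<open>M\<close>, so \<open>n = 2 * k + 1\<close>. If \<open>k \<ge> 2\<close>, then the vertex
  \<open>2\<close> also sees the single vertex \<open>2 + k\<close>, whose label would be \<open>M\<close> again.
\<close>

lemma (in wf_digraph) awalk_cost_one: "awalk_cost (\<lambda>_. 1) p = real (length p)"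
  by (induction p) simp_all

context
  fixes n :: nat
begin

interpretation graph "with_proj (path_graph n)"
  by (rule graph_path_graph)

lemma pverts_path_graph: "pverts (path_graph n) = {1..n}"
  by (simp add: path_graph_def)

text \<open>Every arc joins consecutive numbers, so each step of a walk moves by exactly 1 and the
  triangle inequality adds up. This is the lower bound for distances.\<close>

lemma path_graph_awalk_length:
  assumes "awalk u p v"
  shows "\<bar>real u - real v\<bar> \<le> real (length p)"
  using assms
proof (induction p arbitrary: u)
  case Nil
  then show ?case by (simp add: awalk_Nil_iff)
next
  case (Cons e p)
  then have "e \<in> parcs (path_graph n)" "u = fst e" and "awalk (snd e) p v"
    by (simp_all add: awalk_Cons_iff)
  moreover from this have "\<bar>real u - real (snd e)\<bar> = 1"
    by (auto simp: path_graph_def)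
  ultimately show ?case using Cons.IH by fastforce
qed

text \<open>Moving straight towards \<open>v\<close> stays between \<open>u\<close> and
  \<open>v\<close>, hence on the path. This is the upper bound for distances.\<close>

lemma path_graph_awalk_exists:
  assumes "u \<in> {1..n}" "v \<in> {1..n}" "u = v + d \<or> v = u + d"
  shows "\<exists>p. awalk u p v \<and> length p = d"
  using assms
proof (induction d arbitrary: u)
  case 0
  then have "awalk u [] v" by (auto simp: awalk_Nil_iff pverts_path_graph)
  then show ?case by auto
next
  case (Suc d)
  \<comment> \<open>The difference \<open>Suc d\<close> excludes \<open>u = v\<close>, so the second
    case means \<open>u > v\<close> and the subtraction is not truncated.\<close>
  define w where "w = (if u < v then u + 1 else u - 1)"
  have "w \<in> {1..n}" "w = v + d \<or> v = w + d" and e: "(u, w) \<in> parcs (path_graph n)"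
    using Suc.prems by (auto simp: w_def path_graph_def)
  then obtain p where "awalk w p v" "length p = d"
    using Suc.IH Suc.prems(2) by blast
  with e have "awalk u ((u, w) # p) v" "length ((u, w) # p) = Suc d"
    by (simp_all add: awalk_Cons_iff)
  then show ?case by blast
qed

lemma distance_path_graph:
  assumes "u \<in> {1..n}" "v \<in> {1..n}"
  shows "distance u v = ereal \<bar>real u - real v\<bar>"
proof (rule antisym)
  define d where "d = (if u < v then v - u else u - v)"
  have d: "real d = \<bar>real u - real v\<bar>" "u = v + d \<or> v = u + d"
    by (auto simp: d_def)
  with assms obtain p where "awalk u p v" "length p = d"
    using path_graph_awalk_exists by blast
  then show "distance u v \<le> ereal \<bar>real u - real v\<bar>"
    using min_cost_le_walk_cost[of u p v "\<lambda>_. 1"] d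
    by (simp add: distance_def awalk_cost_one)
  show "ereal \<bar>real u - real v\<bar> \<le> distance u v"
    unfolding distance_def \<mu>_def
    by (rule INF_greatest) (simp add: awalk_cost_one path_graph_awalk_length)
qed

lemma boundary_nbhd_path_graph:
  assumes "u \<in> {1..n}"
  shows "boundary_nbhd k u = {v \<in> {1..n}. v = u + k \<or> u = v + k}"
  unfolding boundary_nbhd_def with_proj_simps pverts_path_graph
  using assms by (intro Collect_cong conj_cong refl) (auto simp: distance_path_graph)

lemma distance_magic_labeling_path_graphD:
  assumes "distance_magic_labeling k f M"
  shows "k = 1 \<and> n = 3"
proof -
  have n: "n \<ge> 3" and inj: "inj_on f {1..n}"
    and ex: "\<exists>u\<in>{1..n}. \<exists>v\<in>{1..n}. distance u v = ereal (real k)"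
    and sum: "\<And>u. u \<in> {1..n} \<Longrightarrow> boundary_nbhd k u \<noteq> {} \<Longrightarrow> sum f (boundary_nbhd k u) = M"
    using assms by (auto simp: distance_magic_labeling_def pverts_path_graph bij_betw_def)
  from ex obtain u v where "u \<in> {1..n}" "v \<in> {1..n}" "\<bar>real u - real v\<bar> = real k"
    by (auto simp: distance_path_graph)
  then have kn: "k < n" by auto
  \<comment> \<open>A sum over one vertex is a label, so by injectivity at most one \<open>w\<close>
    can be the only vertex at distance \<open>k\<close> from some vertex.\<close>
  have single: "f w = M"
    if "u \<in> {1..n}" "{v \<in> {1..n}. v = u + k \<or> u = v + k} = {w}" for u w
    using sum[OF that(1)] unfolding boundary_nbhd_path_graph[OF that(1)] that(2) by simp
  have "k \<noteq> 0"
  proof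
    assume k: "k = 0"
    \<comment> \<open>At distance 0 every vertex sees only itself.\<close>
    have "f 1 = M" "f 2 = M"
      by (rule single; use n k in auto)+
    then show False
      using inj_onD[OF inj, of 1 2] n by simp
  qed
  \<comment> \<open>\<open>k < n\<close> keeps \<open>1 + k\<close> on the path, and
    \<open>k \<noteq> 0\<close> leaves nothing below 1.\<close>
  have first: "f (1 + k) = M"
    by (rule single[of 1]) (use kn \<open>k \<noteq> 0\<close> in auto)
  have "f (n - k) = M"
    by (rule single[of n]) (use kn \<open>k \<noteq> 0\<close> in auto)
  with first have "1 + k = n - k"
    using inj_onD[OF inj, of "1 + k" "n - k"] kn by simp
  then have n_eq: "n = 2 * k + 1" by simp
  have "k < 2"
  proof (rule ccontr)
    assume "\<not> k < 2"
    \<comment> \<open>The candidate \<open>2 - k\<close> below falls off the path because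
      \<open>k \<ge> 2\<close>, while \<open>2 + k \<le> 2 * k + 1 = n\<close>.\<close>
    then have "f (2 + k) = M"
      by (intro single[of 2]) (use n_eq in auto)
    with first show False
      using inj_onD[OF inj, of "1 + k" "2 + k"] n_eq \<open>k \<noteq> 0\<close> by simp
  qed
  with \<open>k \<noteq> 0\<close> n_eq show ?thesis by simp
qed

lemma distance_magic_path_graph_3:
  assumes "n = 3"
  shows "distance_magic 1"
proof -
  \<comment> \<open>The middle label must equal the sum of the two end labels, which forces 3 = 1 +
    2 in the middle.\<close>
  define f :: "nat \<Rightarrow> nat" where "f i = (if i = 1 then 1 else if i = 2 then 3 else 2)" for i
  have V: "{1..n} = {1, 2, 3}" using assms by auto
  have N: "boundary_nbhd 1 1 = {2}" "boundary_nbhd 1 2 = {1, 3}" "boundary_nbhd 1 3 = {2}"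
    by (subst boundary_nbhd_path_graph; unfold V; force)+
  have "bij_betw f {1..n} {1..n}"
    unfolding V by (auto simp: bij_betw_def inj_on_def f_def)
  moreover have "\<exists>u\<in>{1..n}. \<exists>v\<in>{1..n}. distance u v = ereal (real 1)"
    using distance_path_graph[of 1 2] unfolding V by (intro bexI[of _ 1] bexI[of _ 2]) auto
  moreover have "\<forall>u\<in>{1..n}. sum f (boundary_nbhd 1 u) = 3"
    unfolding V using N by (simp add: f_def del: One_nat_def)
  ultimately have "distance_magic_labeling 1 f 3"
    unfolding distance_magic_labeling_def with_proj_simps pverts_path_graph
    using assms by simp
  then show ?thesis
    unfolding distance_magic_def by blast
qed

lemma distance_magic_path_graph_iff: "distance_magic k \<longleftrightarrow> k = 1 \<and> n = 3"
  using distance_magic_labeling_path_graphD distance_magic_path_graph_3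
  unfolding distance_magic_def by blast

end

theorem theorem2p1:
  fixes n k :: nat
  assumes "n \<ge> 2"
  shows "graph.distance_magic (with_proj (path_graph n)) k \<longleftrightarrow> k = 1 \<and> n = 3"
  by (rule distance_magic_path_graph_iff)

end
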